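(* Let $m,n \ge 3$. If there exists a perfect $2$-error-correcting code in the Cartesian product $P_m \square P_n$, then for every integer $k \ge 1$ there exists a quasi-perfect $2$-error-correcting code in $P_m \square P_n \square P_{6k-2}$.
   Context: All graphs are simple and connected; $d(x,y)$ is the shortest-path distance. $P_n$ is the path on $n$ vertices. The Cartesian product $G\square H$ has vertex set $V(G)\times V(H)$, with $(g_1,h_1)$ adjacent to $(g_2,h_2)$ iff either $h_1=h_2$ and $g_1g_2\in E(G)$, or $g_1=g_2$ and $h_1h_2\in E(H)$. A code is a subset $D$ of the vertex set. $D$ is $t$-error-correcting if any two distinct codewords are at distance at least $2t+1$. The covering radius of $D$ is the smallest $r$ such that every vertex is at distance at most $r$ from some codeword. A perfect $t$-error-correcting code is a $t$-error-correcting code with covering radius $t$; a quasi-perfect $t$-error-correcting code is a $t$-error-correcting code with covering radius $t+1$. *)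

theory Defs
  imports "Graph_Theory.Graph_Theory"
begin

text \<open>Simple graphs are represented as symmetric loop-free digraphs (locale \<open>pair_graph\<close>):
  an undirected edge is a pair of opposite arcs.\<close>

definition path_graph :: "nat \<Rightarrow> nat pair_pre_digraph" where
  "path_graph n = \<lparr> pverts = {..<n},
     parcs = {(i, j). i < n \<and> j < n \<and> (j = Suc i \<or> i = Suc j)} \<rparr>"

definition cart_prod ::
  "'a pair_pre_digraph \<Rightarrow> 'b pair_pre_digraph \<Rightarrow> ('a \<times> 'b) pair_pre_digraph"
  (infixl \<open>\<box>\<close> 70) where
  "G \<box> H = \<lparr> pverts = pverts G \<times> pverts H,
     parcs = {((g1, h1), (g2, h2)).
        (h1 = h2 \<and> h1 \<in> pverts H \<and> (g1, g2) \<in> parcs G) \<or>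
        (g1 = g2 \<and> g1 \<in> pverts G \<and> (h1, h2) \<in> parcs H)} \<rparr>"

lemma pair_graph_path_graph: "pair_graph (path_graph n)"
proof -
  have "parcs (path_graph n) \<subseteq> {..<n} \<times> {..<n}"
    by (auto simp: path_graph_def)
  then have "finite (parcs (path_graph n))"
    by (rule finite_subset) simp
  then show ?thesis
    by unfold_locales (auto simp: path_graph_def symmetric_def sym_def arcs_ends_def arc_to_ends_def)
qed

lemma pair_graph_cart_prod:
  assumes "pair_graph G" "pair_graph H"
  shows "pair_graph (G \<box> H)"
proof -
  interpret G: pair_graph G by fact
  interpret H: pair_graph H by fact
  have fin: "finite (pverts (G \<box> H))"
    by (simp add: cart_prod_def)
  have sub: "parcs (G \<box> H) \<subseteq> pverts (G \<box> H) \<times> pverts (G \<box> H)"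
    by (auto simp: cart_prod_def dest: G.in_arcsD1 G.in_arcsD2 H.in_arcsD1 H.in_arcsD2)
  then have "finite (parcs (G \<box> H))"
    using fin by (meson finite_SigmaI finite_subset)
  with fin sub show ?thesis
    by unfold_locales
      (auto simp: cart_prod_def symmetric_def sym_def G.no_loops' H.no_loops'
        dest: G.arcs_symmetric H.arcs_symmetric G.in_arcsD1 G.in_arcsD2 H.in_arcsD1 H.in_arcsD2)
qed

text \<open>With unit weights, the cost of an arc walk is its length, so the library's infimum \<open>\<mu>\<close>
  of walk costs is the shortest-path distance (\<open>\<infinity>\<close> if there is no walk).\<close>

definition graph_dist :: "'a pair_pre_digraph \<Rightarrow> 'a \<Rightarrow> 'a \<Rightarrow> ereal" where
  "graph_dist G u v = wf_digraph.\<mu> (with_proj G) (\<lambda>_. 1) u v"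

definition error_correcting :: "'a pair_pre_digraph \<Rightarrow> nat \<Rightarrow> 'a set \<Rightarrow> bool" where
  "error_correcting G t D \<longleftrightarrow> D \<subseteq> pverts G \<and>
     (\<forall>x\<in>D. \<forall>y\<in>D. x \<noteq> y \<longrightarrow> ereal (real (2 * t + 1)) \<le> graph_dist G x y)"

text \<open>The infimum is over natural numbers, hence attained whenever some radius works; otherwise
  (e.g. for the empty code in a nonempty graph) it is \<open>\<infinity>\<close>.\<close>

definition covering_radius :: "'a pair_pre_digraph \<Rightarrow> 'a set \<Rightarrow> ereal" where
  "covering_radius G D =
     (INF r\<in>{r::nat. \<forall>v\<in>pverts G. \<exists>c\<in>D. graph_dist G v c \<le> ereal (real r)}. ereal (real r))"

definition perfect_code :: "'a pair_pre_digraph \<Rightarrow> nat \<Rightarrow> 'a set \<Rightarrow> bool" where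
  "perfect_code G t D \<longleftrightarrow> error_correcting G t D \<and> covering_radius G D = ereal (real t)"

definition quasi_perfect_code :: "'a pair_pre_digraph \<Rightarrow> nat \<Rightarrow> 'a set \<Rightarrow> bool" where
  "quasi_perfect_code G t D \<longleftrightarrow>
     error_correcting G t D \<and> covering_radius G D = ereal (real (t + 1))"

end

theory Submission
  imports Defs
begin

section \<open>Perfect codes in grids and quasi-perfect codes in boxes\<close>

text \<open>A perfect 2-error-correcting code of an \<open>m \<times> n\<close> grid with \<open>m, n \<ge> 3\<close> exists only if \<open>m = n = 3\<close>, or
  \<open>m = n = 6\<close>, or exactly one side is 3. When both sides are at least 4 this is seen by an exact
  cover search that starts in a corner and dies out after boundedly many cells.

  In each case the box code is a stack of copies of a finite piece \<open>P\<close> of height 6 with a piece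
  \<open>T\<close> of height 4 on top. If one side is 3 and the other at least 4, no codeword of the perfect
  code \<open>D\<close> lies in the middle row, so \<open>D\<close> and its mirror image \<open>E\<close> across that row are at distance at
  least 2; placing \<open>D\<close> and \<open>E\<close> alternately in every third layer gives the code. For \<open>3 \<times> 3\<close> and
  \<open>6 \<times> 6\<close> the pieces are explicit.\<close>

subsection \<open>Distances in grids\<close>

text \<open>Local conditions that pin down the shortest-path distance: \<open>d\<close> drops by at
  most 1 along any arc, and away from the target some arc makes it drop by exactly 1.\<close>

definition geodesic_metric :: "'a pair_pre_digraph \<Rightarrow> ('a \<Rightarrow> 'a \<Rightarrow> nat) \<Rightarrow> bool" where
  "geodesic_metric G d \<longleftrightarrow>
     (\<forall>v\<in>pverts G. d v v = 0) \<and>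
     (\<forall>u w v. (u, w) \<in> parcs G \<longrightarrow> v \<in> pverts G \<longrightarrow> d u v \<le> Suc (d w v)) \<and>
     (\<forall>u\<in>pverts G. \<forall>v\<in>pverts G. u \<noteq> v \<longrightarrow> (\<exists>w. (u, w) \<in> parcs G \<and> d u v = Suc (d w v)))"

text \<open>Since \<open>d\<close> drops by at most 1 per arc, no walk to \<open>v\<close> has fewer
  than \<open>d u v\<close> arcs; following the arcs on which it drops by 1 gives a walk of exactly
  that length, so the infimum is attained.\<close>

lemma graph_dist_eq_geodesic_metric:
  assumes "pair_graph G" and d: "geodesic_metric G d" and "u \<in> pverts G" and v: "v \<in> pverts G"
  shows "graph_dist G u v = ereal (real (d u v))"
proof -
  interpret pair_graph G by fact
  have cost: "awalk_cost (\<lambda>_. 1) p = real (length p)" for p :: "('a \<times> 'a) list"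
    by (induction p) auto
  have lower: "d x v \<le> length p" if "awalk x p v" for x p
    using that
  proof (induction p arbitrary: x)
    case Nil
    then show ?case using d v by (auto simp: awalk_Nil_iff geodesic_metric_def)
  next
    case (Cons e p)
    then have "(x, snd e) \<in> parcs G" "awalk (snd e) p v"
      by (auto simp: awalk_Cons_iff)
    with Cons.IH[of "snd e"] d v show ?case
      unfolding geodesic_metric_def by fastforce
  qed
  have upper: "\<exists>p. awalk x p v \<and> length p = l" if "x \<in> pverts G" "d x v = l" for x l
    using that
  proof (induction l arbitrary: x)
    case 0
    then have "x = v" using d v unfolding geodesic_metric_def by fastforce
    then show ?case using v by (auto simp: awalk_Nil_iff intro!: exI[of _ "[]"])
  next
    case (Suc l)
    have "x \<noteq> v" using d v Suc.prems unfolding geodesic_metric_def by fastforce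
    then obtain w where w: "(x, w) \<in> parcs G" "d x v = Suc (d w v)"
      using d v Suc.prems unfolding geodesic_metric_def by blast
    then obtain p where "awalk w p v" "length p = l"
      using Suc in_arcsD2 by fastforce
    with w show ?case
      by (intro exI[of _ "(x, w) # p"]) (auto simp: awalk_Cons_iff)
  qed
  obtain p where "awalk u p v" "length p = d u v"
    using upper assms(3) by blast
  then show ?thesis
    unfolding graph_dist_def \<mu>_def
    by (intro antisym INF_greatest INF_lower2[of p]) (auto simp: cost lower)
qed

text \<open>Truncated subtraction makes one of the summands 0, so this is the absolute
  difference.\<close>

definition nat_dist :: "nat \<Rightarrow> nat \<Rightarrow> nat" where
  "nat_dist a b = (a - b) + (b - a)"

definition prod_dist :: "('a \<Rightarrow> 'a \<Rightarrow> nat) \<Rightarrow> ('b \<Rightarrow> 'b \<Rightarrow> nat) \<Rightarrow> 'a \<times> 'b \<Rightarrow> 'a \<times> 'b \<Rightarrow> nat" where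
  "prod_dist d e p q = d (fst p) (fst q) + e (snd p) (snd q)"

abbreviation grid_dist :: "nat \<times> nat \<Rightarrow> nat \<times> nat \<Rightarrow> nat" where
  "grid_dist \<equiv> prod_dist nat_dist nat_dist"

abbreviation box_dist :: "(nat \<times> nat) \<times> nat \<Rightarrow> (nat \<times> nat) \<times> nat \<Rightarrow> nat" where
  "box_dist \<equiv> prod_dist grid_dist nat_dist"

lemma geodesic_metric_path_graph: "geodesic_metric (path_graph n) nat_dist"
proof -
  have "\<exists>w. (u, w) \<in> parcs (path_graph n) \<and> nat_dist u v = Suc (nat_dist w v)"
    if "u < n" "v < n" "u \<noteq> v" for u v
    using that
    by (intro exI[of _ "if u < v then Suc u else u - 1"]) (auto simp: path_graph_def nat_dist_def)
  then show ?thesis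
    by (auto simp: geodesic_metric_def path_graph_def nat_dist_def)
qed

text \<open>To descend towards \<open>v\<close>, move in the first factor as long as the first
  coordinates differ, then in the second.\<close>

lemma geodesic_metric_cart_prod:
  assumes G: "geodesic_metric G d" and H: "geodesic_metric H e"
  shows "geodesic_metric (G \<box> H) (prod_dist d e)"
  unfolding geodesic_metric_def
proof (intro conjI ballI allI impI)
  fix v assume "v \<in> pverts (G \<box> H)"
  then show "prod_dist d e v v = 0"
    using G H by (auto simp: geodesic_metric_def prod_dist_def cart_prod_def)
next
  fix u w v assume "(u, w) \<in> parcs (G \<box> H)" "v \<in> pverts (G \<box> H)"
  then show "prod_dist d e u v \<le> Suc (prod_dist d e w v)"
    using G H by (fastforce simp: geodesic_metric_def prod_dist_def cart_prod_def)
next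
  fix u v assume uv: "u \<in> pverts (G \<box> H)" "v \<in> pverts (G \<box> H)" "u \<noteq> v"
  obtain a b a' b' where [simp]: "u = (a, b)" "v = (a', b')" by fastforce
  have V: "a \<in> pverts G" "a' \<in> pverts G" "b \<in> pverts H" "b' \<in> pverts H"
    using uv by (auto simp: cart_prod_def)
  show "\<exists>w. (u, w) \<in> parcs (G \<box> H) \<and> prod_dist d e u v = Suc (prod_dist d e w v)"
  proof (cases "a = a'")
    case False
    then obtain w where "(a, w) \<in> parcs G" "d a a' = Suc (d w a')"
      using G V unfolding geodesic_metric_def by blast
    then show ?thesis using V
      by (intro exI[of _ "(w, b)"]) (auto simp: cart_prod_def prod_dist_def)
  next
    case True
    then obtain w where "(b, w) \<in> parcs H" "e b b' = Suc (e w b')"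
      using H V uv unfolding geodesic_metric_def
      by (metis \<open>u = (a, b)\<close> \<open>v = (a', b')\<close>)
    then show ?thesis using V
      by (intro exI[of _ "(a, w)"]) (auto simp: cart_prod_def prod_dist_def)
  qed
qed

section \<open>Code parameters in terms of an explicit metric\<close>

lemma error_correcting_iff:
  assumes "pair_graph G" "geodesic_metric G d"
  shows "error_correcting G t D \<longleftrightarrow>
    D \<subseteq> pverts G \<and> (\<forall>x\<in>D. \<forall>y\<in>D. x \<noteq> y \<longrightarrow> 2 * t + 1 \<le> d x y)"
proof (cases "D \<subseteq> pverts G")
  case True
  then have "graph_dist G x y = ereal (real (d x y))" if "x \<in> D" "y \<in> D" for x y
    using graph_dist_eq_geodesic_metric[OF assms] that by blast
  then show ?thesis
    by (auto simp: error_correcting_def simp del: of_nat_mult of_nat_Suc)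
qed (simp add: error_correcting_def)

lemma covering_radius_eq_iff:
  assumes "pair_graph G" "geodesic_metric G d" "D \<subseteq> pverts G"
  shows "covering_radius G D = ereal (real r) \<longleftrightarrow>
    (\<forall>v\<in>pverts G. \<exists>c\<in>D. d v c \<le> r) \<and> (\<forall>s<r. \<exists>v\<in>pverts G. \<forall>c\<in>D. s < d v c)"
proof -
  define S where "S = {s. \<forall>v\<in>pverts G. \<exists>c\<in>D. d v c \<le> s}"
  have "graph_dist G v c \<le> ereal (real s) \<longleftrightarrow> d v c \<le> s" if "v \<in> pverts G" "c \<in> D" for v c s
    using graph_dist_eq_geodesic_metric[OF assms(1,2)] that assms(3) by auto
  then have radius: "covering_radius G D = (INF s\<in>S. ereal (real s))"
    unfolding covering_radius_def S_def by (intro INF_cong) auto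
  have least: "(INF s\<in>S. ereal (real s)) = ereal (real s0)"
    if "s0 \<in> S" "\<forall>s\<in>S. s0 \<le> s" for s0
    using that by (intro antisym INF_greatest INF_lower2[of s0]) auto
  have "covering_radius G D = ereal (real r) \<longleftrightarrow> r \<in> S \<and> (\<forall>s\<in>S. r \<le> s)"
  proof (cases "S = {}")
    \<comment> \<open>With no admissible radius the infimum is \<open>\<infinity>\<close>, so both
      sides of the equivalence fail.\<close>
    case True
    then show ?thesis by (simp add: radius top_ereal_def)
  next
    case False
    then have "(LEAST s. s \<in> S) \<in> S" "\<forall>s\<in>S. (LEAST s. s \<in> S) \<le> s"
      by (auto intro: LeastI Least_le)
    with least show ?thesis unfolding radius
      by (metis ereal.inject of_nat_eq_iff)
  qed
  also have "\<dots> \<longleftrightarrow> r \<in> S \<and> (\<forall>s<r. s \<notin> S)"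
    using linorder_not_le by blast
  also have "\<dots> \<longleftrightarrow> (\<forall>v\<in>pverts G. \<exists>c\<in>D. d v c \<le> r) \<and> (\<forall>s<r. \<exists>v\<in>pverts G. \<forall>c\<in>D. s < d v c)"
    by (simp add: S_def not_le)
  finally show ?thesis .
qed

lemma grid_dist_commute: "grid_dist p q = grid_dist q p"
  by (simp add: prod_dist_def nat_dist_def)

lemma box_dist_commute: "box_dist x y = box_dist y x"
  by (simp add: prod_dist_def nat_dist_def)

lemma grid_dist_triangle: "grid_dist p r \<le> grid_dist p q + grid_dist q r"
proof -
  have "nat_dist a c \<le> nat_dist a b + nat_dist b c" for a b c
    by (simp add: nat_dist_def)
  from this[of "fst p" "fst r" "fst q"] this[of "snd p" "snd r" "snd q"] show ?thesis
    by (simp add: prod_dist_def)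
qed

text \<open>The bound 5 is \<open>2 * t + 1\<close> for \<open>t = 2\<close>.\<close>

definition separated :: "('a \<Rightarrow> 'a \<Rightarrow> nat) \<Rightarrow> 'a set \<Rightarrow> bool" where
  "separated d D \<longleftrightarrow> (\<forall>x\<in>D. \<forall>y\<in>D. x \<noteq> y \<longrightarrow> 5 \<le> d x y)"

definition covers :: "('a \<Rightarrow> 'a \<Rightarrow> nat) \<Rightarrow> nat \<Rightarrow> 'a set \<Rightarrow> 'a set \<Rightarrow> bool" where
  "covers d r V D \<longleftrightarrow> (\<forall>v\<in>V. \<exists>c\<in>D. d v c \<le> r)"

subsection \<open>Perfect codes in grids with sides at least 4\<close>

definition candidates :: "nat \<Rightarrow> nat \<Rightarrow> nat \<times> nat \<Rightarrow> (nat \<times> nat) list" where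
  "candidates M N v = filter (\<lambda>c. grid_dist v c \<le> 2)
     (List.product [fst v - 2..<min M (fst v + 3)] [snd v - 2..<min N (snd v + 3)])"

definition extend_code :: "nat \<Rightarrow> nat \<Rightarrow> nat \<times> nat \<Rightarrow> (nat \<times> nat) list \<Rightarrow> (nat \<times> nat) list list" where
  "extend_code M N v cs =
    (if list_ex (\<lambda>c. grid_dist v c \<le> 2) cs then [cs]
     else map (\<lambda>c. c # cs) (filter (\<lambda>c. list_all (\<lambda>c'. 5 \<le> grid_dist c c') cs) (candidates M N v)))"

primrec partial_codes :: "nat \<Rightarrow> nat \<Rightarrow> (nat \<times> nat) list \<Rightarrow> (nat \<times> nat) list list \<Rightarrow> (nat \<times> nat) list list" where
  "partial_codes M N [] css = css"
| "partial_codes M N (v # vs) css = partial_codes M N vs (concat (map (extend_code M N v) css))"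

text \<open>Cells are listed by antidiagonals, which keeps the search tree small.\<close>

definition cells :: "nat \<Rightarrow> nat \<Rightarrow> (nat \<times> nat) list" where
  "cells a b = filter (\<lambda>(x, y). x < a \<and> y < b)
     (concat (map (\<lambda>s. map (\<lambda>x. (x, s - x)) [0..<Suc s]) [0..<a + b]))"

text \<open>Search invariant: some branch stays inside the actual code \<open>D\<close>. An empty
  list of branches therefore refutes the existence of \<open>D\<close>.\<close>

lemma extend_code_sound:
  assumes "separated grid_dist D" "set cs \<subseteq> D" "c \<in> D" "grid_dist v c \<le> 2"
    and "fst c < M" "snd c < N"
  shows "\<exists>cs'\<in>set (extend_code M N v cs). set cs' \<subseteq> D"
proof (cases "list_ex (\<lambda>c. grid_dist v c \<le> 2) cs")
  case True
  then show ?thesis using assms(2) by (simp add: extend_code_def)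
next
  case False
  then have "c \<notin> set cs" using assms(4) by (auto simp: list_ex_iff)
  then have "5 \<le> grid_dist c c'" if "c' \<in> set cs" for c'
    using assms(1-3) that unfolding separated_def by (metis subsetD)
  then have "list_all (\<lambda>c'. 5 \<le> grid_dist c c') cs"
    by (simp add: list_all_iff)
  moreover have "c \<in> set (candidates M N v)"
    using assms(4-) by (cases c) (auto simp: candidates_def prod_dist_def nat_dist_def)
  ultimately have "c # cs \<in> set (extend_code M N v cs)"
    using False by (auto simp: extend_code_def)
  then show ?thesis using assms(2,3) by (intro bexI) auto
qed

lemma partial_codes_sound:
  assumes "separated grid_dist D" "\<exists>cs\<in>set css. set cs \<subseteq> D"
    and "\<forall>v\<in>set vs. \<exists>c\<in>D. grid_dist v c \<le> 2 \<and> fst c < M \<and> snd c < N"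
  shows "\<exists>cs\<in>set (partial_codes M N vs css). set cs \<subseteq> D"
  using assms(2,3)
proof (induction vs arbitrary: css)
  case (Cons v vs)
  then obtain cs c where "cs \<in> set css" "set cs \<subseteq> D" "c \<in> D" "grid_dist v c \<le> 2" "fst c < M" "snd c < N"
    by auto
  then have "\<exists>cs'\<in>set (concat (map (extend_code M N v) css)). set cs' \<subseteq> D"
    using extend_code_sound[OF assms(1), of cs c v M N] by auto
  then show ?case using Cons by simp
qed simp

text \<open>A codeword within distance 2 of a cell with coordinates below 7 has coordinates below 9, so a
  search over these cells cannot tell a side of length at least 9 from one of length 9.\<close>

definition extent :: "nat \<Rightarrow> nat" where
  "extent M = (if M < 9 then M else 7)"

text \<open>The finite computation behind the classification; the value 9 stands for every side of
  length at least 9.\<close>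

lemma partial_codes_empty:
  "list_all (\<lambda>(M, N). (M, N) = (6, 6) \<or> partial_codes M N (cells (extent M) (extent N)) [[]] = [])
     (List.product [4..<10] [4..<10])"
  by code_simp

lemma perfect_grid_code_size:
  assumes D: "D \<subseteq> {..<m} \<times> {..<n}" "separated grid_dist D"
    and cov: "covers grid_dist 2 ({..<m} \<times> {..<n}) D"
    and mn: "4 \<le> m" "4 \<le> n"
  shows "m = 6 \<and> n = 6"
proof -
  define M N where "M = min m 9" and "N = min n 9"
  have "\<exists>c\<in>D. grid_dist v c \<le> 2 \<and> fst c < M \<and> snd c < N"
    if "v \<in> set (cells (extent M) (extent N))" for v
  proof -
    obtain x y where v: "v = (x, y)" "x < extent M" "y < extent N"
      using \<open>v \<in> _\<close> by (auto simp: cells_def)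
    then have "x < m" "y < n"
      by (auto simp: extent_def M_def N_def split: if_splits)
    then obtain a b where c: "(a, b) \<in> D" "grid_dist v (a, b) \<le> 2"
      using cov v by (fastforce simp: covers_def)
    then have "a < m" "b < n" using D by auto
    moreover have "a \<le> x + 2" "b \<le> y + 2"
      using c v by (auto simp: prod_dist_def nat_dist_def)
    ultimately have "a < M" "b < N"
      using v by (auto simp: extent_def M_def N_def split: if_splits)
    then show ?thesis using c by auto
  qed
  then have "partial_codes M N (cells (extent M) (extent N)) [[]] \<noteq> []"
    using partial_codes_sound[OF D(2), of "[[]]" "cells (extent M) (extent N)" M N] by force
  moreover have "M \<in> set [4..<10]" "N \<in> set [4..<10]"
    using mn by (auto simp: M_def N_def)
  ultimately have "M = 6 \<and> N = 6"
    using partial_codes_empty unfolding list_all_iff by fastforce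
  \<comment> \<open>As 6 lies below the cap 9, the capped sides determine the true ones.\<close>
  then show ?thesis by (auto simp: M_def N_def min_def split: if_splits)
qed

subsection \<open>Stacking\<close>

abbreviation box :: "nat \<Rightarrow> nat \<Rightarrow> nat set \<Rightarrow> ((nat \<times> nat) \<times> nat) set" where
  "box m n Z \<equiv> ({..<m} \<times> {..<n}) \<times> Z"

definition raise :: "(nat \<times> nat) \<times> nat \<Rightarrow> (nat \<times> nat) \<times> nat" where
  "raise x = (fst x, snd x + 6)"

text \<open>Codewords two or more pieces apart are automatically at distance at least 5, and a piece is
  covered without help from the piece below it, so all conditions concern \<open>A\<close> and the next piece \<open>B\<close>.\<close>

definition linked ::
  "nat \<Rightarrow> nat \<Rightarrow> ((nat \<times> nat) \<times> nat) set \<Rightarrow> ((nat \<times> nat) \<times> nat) set \<Rightarrow> bool" where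
  "linked m n A B \<longleftrightarrow>
     (\<forall>x\<in>A. \<forall>y\<in>B. 5 \<le> box_dist x (raise y)) \<and>
     covers box_dist 3 (box m n {..<6}) (A \<union> raise ` B)"

text \<open>The last clause keeps the covering radius from being 2: some cell of the top piece is
  far from \<open>T\<close> and from a copy of \<open>P\<close> just below. There
  \<open>raise\<close> shifts the top piece up, so that this \<open>P\<close> keeps its
  coordinates.\<close>

definition stackable :: "nat \<Rightarrow> nat \<Rightarrow> bool" where
  "stackable m n \<longleftrightarrow> (\<exists>P T.
     P \<subseteq> box m n {..<6} \<and> T \<subseteq> box m n {..<4} \<and>
     separated box_dist P \<and> separated box_dist T \<and>
     linked m n P P \<and> linked m n P T \<and> covers box_dist 3 (box m n {..<4}) T \<and>
     \<not> covers box_dist 2 (raise ` box m n {..<4}) (P \<union> raise ` T))"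

text \<open>The code consists of \<open>k - 1\<close> copies of \<open>P\<close> with
  \<open>T\<close> on top, of total height \<open>6 * (k - 1) + 4 = 6 * k - 2\<close>.\<close>

lemma stackable_imp_quasi_perfect_code:
  assumes "stackable m n" "1 \<le> k"
  shows "\<exists>D. quasi_perfect_code (path_graph m \<box> path_graph n \<box> path_graph (6 * k - 2)) 2 D"
proof -
  let ?G = "path_graph m \<box> path_graph n \<box> path_graph (6 * k - 2)"
  obtain P T where P: "P \<subseteq> box m n {..<6}" "separated box_dist P" "linked m n P P"
    and T: "T \<subseteq> box m n {..<4}" "separated box_dist T" "linked m n P T"
      "covers box_dist 3 (box m n {..<4}) T"
    and far: "\<not> covers box_dist 2 (raise ` box m n {..<4}) (P \<union> raise ` T)"
    using assms(1) by (auto simp: stackable_def)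
  define S where "S q = (if Suc q = k then T else P)" for q
  define D where "D = {(p, 6 * q + z) | p z q. q < k \<and> (p, z) \<in> S q}"
  have G: "pair_graph ?G" "geodesic_metric ?G box_dist"
    by (intro pair_graph_cart_prod pair_graph_path_graph
        geodesic_metric_cart_prod geodesic_metric_path_graph)+
  have V: "pverts ?G = box m n {..<6 * k - 2}"
    by (simp add: cart_prod_def path_graph_def)
  have height: "z < 6" if "(p, z) \<in> S q" for p z q
    using P(1) T(1) that by (auto simp: S_def split: if_splits)
  have sub: "D \<subseteq> pverts ?G"
  proof
    fix x assume "x \<in> D"
    then obtain p z q where x: "x = (p, 6 * q + z)" "q < k" "(p, z) \<in> S q"
      unfolding D_def by blast
    have "p \<in> {..<m} \<times> {..<n}" "6 * q + z < 6 * k - 2"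
      using x P(1) T(1) by (auto simp: S_def split: if_splits)
    then show "x \<in> pverts ?G" using x by (auto simp: V)
  qed

  have less: "5 \<le> box_dist (p, 6 * q + z) (p', 6 * q' + z')"
    if "(p, z) \<in> S q" "(p', z') \<in> S q'" "q < q'" "q' < k" for p z q p' z' q'
  proof (cases "q' = Suc q")
    case True
    then have "5 \<le> box_dist (p, z) (raise (p', z'))"
      using that P(3) T(3) by (auto simp: linked_def S_def split: if_splits)
    then show ?thesis using True by (simp add: prod_dist_def nat_dist_def raise_def algebra_simps)
  next
    case False
    \<comment> \<open>Pieces two levels apart: the heights differ by at least 12 - 5 = 7.\<close>
    then have "q' \<ge> q + 2" using that by simp
    then show ?thesis using height[OF that(1)] by (simp add: prod_dist_def nat_dist_def)
  qed
  have "5 \<le> box_dist (p, 6 * q + z) (p', 6 * q' + z')"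
    if "(p, z) \<in> S q" "(p', z') \<in> S q'" "q < k" "q' < k" "(p, 6 * q + z) \<noteq> (p', 6 * q' + z')"
    for p z q p' z' q'
  proof -
    consider "q < q'" | "q' < q" | "q = q'" by linarith
    then show ?thesis
    proof cases
      case 3
      have "separated box_dist (S q)" using P(2) T(2) by (simp add: S_def)
      moreover have "(p, z) \<noteq> (p', z')" "(p', z') \<in> S q" using 3 that by auto
      ultimately have "5 \<le> box_dist (p, z) (p', z')"
        using that(1) unfolding separated_def by blast
      then show ?thesis using 3 by (simp add: prod_dist_def nat_dist_def)
    next
      case 1
      then show ?thesis using less[OF that(1,2)] that(4) by simp
    next
      case 2
      then show ?thesis using less[OF that(2,1)] that(3) by (simp add: box_dist_commute)
    qed
  qed
  then have "\<forall>x\<in>D. \<forall>y\<in>D. x \<noteq> y \<longrightarrow> 5 \<le> box_dist x y"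
    unfolding D_def by blast
  then have correcting: "error_correcting ?G 2 D"
    using sub by (subst error_correcting_iff[OF G]) simp

  have cover: "\<exists>c\<in>D. box_dist v c \<le> 3" if v_in: "v \<in> pverts ?G" for v
  proof -
    obtain p h where v: "v = (p, h)" "p \<in> {..<m} \<times> {..<n}" "h < 6 * k - 2"
      using v_in unfolding V by auto
    define q z where "q = h div 6" and "z = h mod 6"
    have h: "h = 6 * q + z" "z < 6" "q < k" using v(3) by (auto simp: q_def z_def)
    have in_D: "(p', 6 * q' + z') \<in> D" if "(p', z') \<in> S q'" "q' < k" for p' z' q'
      using that unfolding D_def by blast
    have "\<exists>c. (fst c, 6 * q + snd c) \<in> D \<and> box_dist (p, z) c \<le> 3"
    proof (cases "Suc q = k")
      case True
      then have "(p, z) \<in> box m n {..<4}" using v h by auto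
      then obtain c where "c \<in> T" "box_dist (p, z) c \<le> 3"
        using T(4) unfolding covers_def by blast
      then show ?thesis using in_D[of "fst c" "snd c" q] h True
        by (intro exI[of _ c]) (simp add: S_def)
    next
      case False
      then have "Suc q < k" using h by simp
      have "covers box_dist 3 (box m n {..<6}) (S q \<union> raise ` S (Suc q))"
        using False P(3) T(3) by (simp add: S_def linked_def)
      moreover have "(p, z) \<in> box m n {..<6}" using v h by auto
      ultimately obtain c where c: "c \<in> S q \<union> raise ` S (Suc q)" "box_dist (p, z) c \<le> 3"
        unfolding covers_def by blast
      \<comment> \<open>A codeword from the next piece has \<open>snd c\<close> at least 6;
        subtracting 6 gives its height inside that piece.\<close>
      then have "(fst c, 6 * q + snd c) \<in> D"
        using in_D[of "fst c" "snd c" q] in_D[of "fst c" "snd c - 6" "Suc q"] h \<open>Suc q < k\<close>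
        by (auto simp: raise_def algebra_simps)
      with c show ?thesis by blast
    qed
    then obtain c where "(fst c, 6 * q + snd c) \<in> D" "box_dist (p, z) c \<le> 3" by blast
    moreover have "box_dist v (fst c, 6 * q + snd c) = box_dist (p, z) c"
      using h v by (simp add: prod_dist_def nat_dist_def)
    ultimately show ?thesis by metis
  qed

  obtain v where v: "v \<in> pverts ?G" and far: "\<And>c. c \<in> D \<Longrightarrow> 2 < box_dist v c"
  proof -
    obtain p h where v: "p \<in> {..<m} \<times> {..<n}" "h < 4"
      and far_v: "\<And>c. c \<in> P \<union> raise ` T \<Longrightarrow> 2 < box_dist (raise (p, h)) c"
      using far by (auto simp: covers_def not_le)
    \<comment> \<open>The uncovered cell, moved to the top piece. Only \<open>T\<close> and the
      \<open>P\<close> below it, if \<open>k\<close> is at least 2, can come near; lower pieces are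
      at least 7 layers away.\<close>
    let ?v = "(p, 6 * (k - 1) + h)"
    have "2 < box_dist ?v c" if c_in: "c \<in> D" for c
    proof -
      obtain p' z q where c: "c = (p', 6 * q + z)" "q < k" "(p', z) \<in> S q"
        using \<open>c \<in> D\<close> unfolding D_def by blast
      consider "k = q + 1" | "k = q + 2" | "q + 3 \<le> k"
        using c(2) by linarith
      then show ?thesis
      proof cases
        case 1
        then have "(p', z) \<in> T" using c by (simp add: S_def)
        then have "2 < box_dist (raise (p, h)) (raise (p', z))"
          by (intro far_v) blast
        then show ?thesis using 1 c by (simp add: raise_def prod_dist_def nat_dist_def)
      next
        case 2
        then have "2 < box_dist (raise (p, h)) (p', z)"
          using c by (intro far_v) (simp add: S_def)
        then show ?thesis using 2 c by (simp add: raise_def prod_dist_def nat_dist_def algebra_simps)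
      next
        case 3
        then show ?thesis using c(1) height[OF c(3)] by (simp add: prod_dist_def nat_dist_def)
      qed
    qed
    moreover have "?v \<in> pverts ?G" using v assms(2) by (auto simp: V)
    ultimately show ?thesis by (rule that[rotated])
  qed
  have "s < box_dist v c" if "s < 3" "c \<in> D" for s c
    using far[OF that(2)] that(1) by linarith
  with cover v have "covering_radius ?G D = ereal (real 3)"
    unfolding covering_radius_eq_iff[OF G sub] by blast
  with correcting show ?thesis
    unfolding quasi_perfect_code_def by auto
qed

text \<open>Exchanging the two horizontal coordinates is an isometry that commutes with
  \<open>raise\<close>.\<close>

lemma stackable_commute:
  assumes "stackable m n"
  shows "stackable n m"
proof -
  define s where "s x = ((snd (fst x), fst (fst x)), snd x)" for x :: "(nat \<times> nat) \<times> nat"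
  have d: "box_dist (s x) (s y) = box_dist x y" for x y
    by (simp add: s_def prod_dist_def)
  have r: "raise (s x) = s (raise x)" for x
    by (simp add: s_def raise_def)
  have b: "box n m Z = s ` box m n Z" for Z
    by (force simp: s_def image_iff)
  have cov: "covers box_dist r (s ` X) (s ` C) \<longleftrightarrow> covers box_dist r X C" for r X C
    unfolding covers_def by (simp add: d)
  have sep: "separated box_dist (s ` A)" if "separated box_dist A" for A
    using that by (auto simp: separated_def d)
  have raise_image: "raise ` s ` A = s ` raise ` A" for A
    by (simp add: image_image r)
  have linked: "linked n m (s ` A) (s ` B)" if "linked m n A B" for A B
    using that unfolding linked_def b raise_image image_Un[symmetric] cov by (simp add: d r)
  obtain P T where "P \<subseteq> box m n {..<6}" "T \<subseteq> box m n {..<4}"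
    "separated box_dist P" "separated box_dist T" "linked m n P P" "linked m n P T"
    "covers box_dist 3 (box m n {..<4}) T"
    "\<not> covers box_dist 2 (raise ` box m n {..<4}) (P \<union> raise ` T)"
    using assms by (auto simp: stackable_def)
  then show ?thesis
    unfolding stackable_def b
    by (intro exI[of _ "s ` P"] exI[of _ "s ` T"])
      (simp add: raise_image image_Un[symmetric] cov sep linked image_mono)
qed

subsection \<open>The pieces for the three kinds of grids\<close>

text \<open>Turns the quantifiers over boxes into list checks that can be evaluated.\<close>

lemma box_eq_set: "box m n {..<h} = set (List.product (List.product [0..<m] [0..<n]) [0..<h])"
  by auto

text \<open>Treated apart because the perfect code \<open>{(1, 1)}\<close> lies in the middle row
  and equals its mirror image. The piece used here alternates between two opposite corners.\<close>

lemma stackable_3_3: "stackable 3 3"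
  unfolding stackable_def linked_def separated_def covers_def box_eq_set
  by (rule exI[of _ "set [((0, 0), 0), ((2, 2), 3)]"], rule exI[of _ "set [((0, 0), 0), ((2, 2), 3)]"])
    code_simp

text \<open>These pieces were found by a SAT search; there is no solution with \<open>P = T\<close>.\<close>

lemma stackable_6_6: "stackable 6 6"
  unfolding stackable_def linked_def separated_def covers_def box_eq_set
  by (rule exI[of _ "set [((0, 0), 4), ((0, 5), 0), ((1, 1), 1), ((1, 4), 3), ((3, 2), 4), ((4, 4), 0),
        ((5, 0), 1), ((5, 5), 3)]"],
      rule exI[of _ "set [((0, 3), 3), ((0, 5), 0), ((1, 1), 1), ((3, 4), 1), ((4, 0), 3), ((5, 1), 0),
        ((5, 5), 3)]"])
    code_simp

text \<open>Two columns away from \<open>(1, j)\<close>, the cells in rows 0 and 2 are at distance 3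
  from it. The codewords covering them must lie in their own rows, two columns further on, and are
  then too close to each other.\<close>

lemma no_codeword_in_middle_row:
  assumes D: "D \<subseteq> {..<3} \<times> {..<n}" "separated grid_dist D"
    and cov: "covers grid_dist 2 ({..<3} \<times> {..<n}) D"
    and n: "4 \<le> n"
  shows "(1, j) \<notin> D"
proof
  assume j: "(1, j) \<in> D"
  have sep: "5 \<le> grid_dist x y" if "x \<in> D" "y \<in> D" "x \<noteq> y" for x y
    using D(2) that by (simp add: separated_def)
  \<comment> \<open>Since \<open>n\<close> is at least 4, \<open>j - 2\<close> is a genuine
    subtraction when it is used.\<close>
  define l where "l = (if j + 2 < n then j + 2 else j - 2)"
  have l: "l < n" "l = j + 2 \<or> j = l + 2"
    using n j D(1) by (auto simp: l_def)
  have corner: "\<exists>b. (i, b) \<in> D \<and> nat_dist l b = 2" if i: "i = 0 \<or> i = 2" for i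
  proof -
    have "(i, l) \<in> {..<3} \<times> {..<n}" using i l by auto
    then obtain a b where c: "(a, b) \<in> D" "grid_dist (i, l) (a, b) \<le> 2"
      using cov unfolding covers_def by fastforce
    have "a < 3" using c D(1) by auto
    have "(a, b) \<noteq> (1, j)"
      using c(2) i l(2) by (auto simp: prod_dist_def nat_dist_def)
    then have "5 \<le> grid_dist (1, j) (a, b)" using sep j c by metis
    with c(2) i l(2) \<open>a < 3\<close> have "a = i \<and> nat_dist l b = 2"
      by (auto simp: prod_dist_def nat_dist_def)
    then show ?thesis using c by auto
  qed
  obtain b b' where b: "(0, b) \<in> D" "nat_dist l b = 2" "(2, b') \<in> D" "nat_dist l b' = 2"
    using corner[of 0] corner[of 2] by auto
  \<comment> \<open>The first two bounds exclude column \<open>j\<close>, so \<open>b = b'\<close>,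
    against the third.\<close>
  have "5 \<le> grid_dist (1, j) (0, b)" "5 \<le> grid_dist (1, j) (2, b')" "5 \<le> grid_dist (0, b) (2, b')"
    using sep j b by auto
  then show False
    using b l(2) by (auto simp: prod_dist_def nat_dist_def)
qed

text \<open>Both pieces are \<open>A\<close>: the code \<open>D\<close> in layer 0 and its mirror
  image \<open>E\<close> in layer 3. Horizontal distance 2 plus vertical distance 3 gives the
  required 5.\<close>

lemma stackable_3:
  assumes D: "D \<subseteq> {..<3} \<times> {..<n}" "separated grid_dist D"
    and cov: "covers grid_dist 2 ({..<3} \<times> {..<n}) D"
    and n: "4 \<le> n"
  shows "stackable 3 n"
proof -
  define E where "E = (\<lambda>(i, j). (2 - i, j)) ` D"
  define A where "A = D \<times> {0} \<union> E \<times> {3::nat}"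
  have sep: "5 \<le> grid_dist x y" if "x \<in> D" "y \<in> D" "x \<noteq> y" for x y
    using D(2) that by (simp add: separated_def)
  have row: "i = 0 \<or> i = 2" if "(i, j) \<in> D" for i j
  proof -
    have "i < 3" using that D(1) by auto
    moreover have "i \<noteq> 1" using no_codeword_in_middle_row[OF assms] that by auto
    ultimately show ?thesis by linarith
  qed
  have E: "E \<subseteq> {..<3} \<times> {..<n}" using D(1) by (auto simp: E_def)
  have sepE: "5 \<le> grid_dist x y" if E_xy: "x \<in> E" "y \<in> E" "x \<noteq> y" for x y
  proof -
    obtain i j i' j' where xy: "x = (2 - i, j)" "(i, j) \<in> D" "y = (2 - i', j')" "(i', j') \<in> D"
      using E_xy by (auto simp: E_def)
    then have "5 \<le> grid_dist (i, j) (i', j')" using sep E_xy by fastforce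
    then show ?thesis using xy row[of i j] row[of i' j'] by (auto simp: prod_dist_def nat_dist_def)
  qed
  have covE: "\<exists>c\<in>E. grid_dist v c \<le> 2" if v_in: "v \<in> {..<3} \<times> {..<n}" for v
  proof -
    obtain x y where v: "v = (x, y)" "x < 3" "y < n" using v_in by auto
    then have "(2 - x, y) \<in> {..<3} \<times> {..<n}" by auto
    then obtain i j where "(i, j) \<in> D" "grid_dist (2 - x, y) (i, j) \<le> 2"
      using cov unfolding covers_def by fastforce
    then show ?thesis using v row[of i j]
      by (intro bexI[of _ "(2 - i, j)"]) (auto simp: E_def prod_dist_def nat_dist_def intro: rev_image_eqI)
  qed
  have covD: "\<exists>c\<in>D. grid_dist v c \<le> 2" if "v \<in> {..<3} \<times> {..<n}" for v
    using cov that by (auto simp: covers_def)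
  have DE: "2 \<le> grid_dist x y" if DE_xy: "x \<in> D" "y \<in> E" for x y
  proof -
    obtain i j i' j' where xy: "x = (i, j)" "(i, j) \<in> D" "y = (2 - i', j')" "(i', j') \<in> D"
      using DE_xy by (cases x) (auto simp: E_def)
    \<comment> \<open>All rows are 0 or 2: a codeword and its own mirror image are 2 rows apart, and
      distinct codewords are at least 3 columns apart.\<close>
    have "i = i' \<and> j = j' \<or> 5 \<le> grid_dist (i, j) (i', j')" using sep xy by blast
    then show ?thesis using xy row[of i j] row[of i' j'] by (auto simp: prod_dist_def nat_dist_def)
  qed
  have ED: "2 \<le> grid_dist y x" if "x \<in> D" "y \<in> E" for x y
    using DE[OF that] by (simp add: grid_dist_commute)
  have box_dist: "box_dist (p, z) (q, w) = grid_dist p q + nat_dist z w" for p q z w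
    by (simp add: prod_dist_def)
  have "separated box_dist A"
    unfolding separated_def
  proof (intro ballI impI)
    fix x y assume "x \<in> A" "y \<in> A" "x \<noteq> y"
    then show "5 \<le> box_dist x y"
      using sep sepE DE ED by (fastforce simp: A_def box_dist nat_dist_def)
  qed
  \<comment> \<open>Layers 0 to 4 are within 1 of layer 0 or 3. Layer 5 relies on layer 0 of the
    next piece.\<close>
  moreover have low: "\<exists>c\<in>A. box_dist (p, z) c \<le> 3" if pz: "p \<in> {..<3} \<times> {..<n}" "z < 5" for p z
  proof -
    obtain c c' where "c \<in> D" "grid_dist p c \<le> 2" "c' \<in> E" "grid_dist p c' \<le> 2"
      using covD covE pz by blast
    then show ?thesis
      using pz by (intro bexI[of _ "if z < 2 then (c, 0) else (c', 3)"])
        (auto simp: A_def box_dist nat_dist_def)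
  qed
  moreover have "linked 3 n A A"
    unfolding linked_def covers_def
  proof (intro conjI ballI)
    fix x y assume "x \<in> A" "y \<in> A"
    then show "5 \<le> box_dist x (raise y)"
      using DE ED by (fastforce simp: A_def raise_def box_dist nat_dist_def)
  next
    fix v assume "v \<in> box 3 n {..<6}"
    then obtain p z where v: "v = (p, z)" "p \<in> {..<3} \<times> {..<n}" "z < 5 \<or> z = 5" by force
    obtain c where c: "c \<in> D" "grid_dist p c \<le> 2"
      using covD v by blast
    have "raise (c, 0) \<in> raise ` A" using c by (auto simp: A_def)
    moreover have "z = 5 \<Longrightarrow> box_dist v (raise (c, 0)) \<le> 3"
      using v c by (simp add: raise_def box_dist nat_dist_def)
    ultimately show "\<exists>c\<in>A \<union> raise ` A. box_dist v c \<le> 3"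
      using v low by blast
  qed
  moreover have "\<not> covers box_dist 2 (raise ` box 3 n {..<4}) (A \<union> raise ` A)"
  proof -
    obtain i j where c: "(i, j) \<in> D" using covD[of "(0, 0)"] n by auto
    \<comment> \<open>The cell \<open>(1, l)\<close> is diagonal to a codeword: at distance at least
      2 from \<open>D\<close>, and at least 1 from \<open>E\<close>, which avoids row 1. In layer 1
      it is 1 from the layer of \<open>D\<close> and 2 from that of \<open>E\<close>, so both totals
      are at least 3.\<close>
    define l where "l = (if j + 1 < n then j + 1 else j - 1)"
    have l: "l < n" "l = j + 1 \<or> j = l + 1" using n c D(1) by (auto simp: l_def)
    have "2 < box_dist ((1, l), 1) x" if x_in: "x \<in> A" for x
    proof -
      obtain p z where x: "x = (p, z)" "p \<in> D \<and> z = 0 \<or> p \<in> E \<and> z = 3"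
        using x_in by (auto simp: A_def)
      have "2 \<le> grid_dist (1, l) p" if "p \<in> D"
      proof (cases "p = (i, j)")
        case True
        then show ?thesis using l row[OF c] by (auto simp: prod_dist_def nat_dist_def)
      next
        case False
        then have "5 \<le> grid_dist (i, j) p" using sep c that by blast
        moreover have "grid_dist (i, j) (1, l) = 2"
          using l row[OF c] by (auto simp: prod_dist_def nat_dist_def)
        ultimately show ?thesis using grid_dist_triangle[of "(i, j)" p "(1, l)"] by linarith
      qed
      moreover have "1 \<le> grid_dist (1, l) p" if "p \<in> E"
        using that row by (fastforce simp: E_def prod_dist_def nat_dist_def)
      ultimately show ?thesis using x by (auto simp: box_dist nat_dist_def)
    qed
    \<comment> \<open>The raised cell is in layer 7, at least 4 above the unraised
      \<open>A\<close>.\<close>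
    then have "2 < box_dist (raise ((1, l), 1)) x" if "x \<in> A \<union> raise ` A" for x
      using that by (fastforce simp: A_def raise_def box_dist nat_dist_def)
    moreover have "raise ((1, l), 1) \<in> raise ` box 3 n {..<4}" using l by simp
    ultimately show ?thesis unfolding covers_def by (meson not_le)
  qed
  moreover have "A \<subseteq> box 3 n {..<4}" "A \<subseteq> box 3 n {..<6}"
    using D(1) E by (auto simp: A_def)
  moreover have "covers box_dist 3 (box 3 n {..<4}) A"
    using low by (fastforce simp: covers_def)
  ultimately show ?thesis unfolding stackable_def by blast
qed

section \<open>Case split over the shape of the grid\<close>

lemma perfect_code_imp_stackable:
  assumes "3 \<le> m" "3 \<le> n" and "perfect_code (path_graph m \<box> path_graph n) 2 D"
  shows "stackable m n"
proof -
  let ?G = "path_graph m \<box> path_graph n"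
  have G: "pair_graph ?G" "geodesic_metric ?G grid_dist"
    by (intro pair_graph_cart_prod pair_graph_path_graph
        geodesic_metric_cart_prod geodesic_metric_path_graph)+
  have V: "pverts ?G = {..<m} \<times> {..<n}"
    by (simp add: cart_prod_def path_graph_def)
  have D: "D \<subseteq> {..<m} \<times> {..<n}" "separated grid_dist D"
    using assms(3) unfolding perfect_code_def error_correcting_iff[OF G] V separated_def by auto
  have cov: "covers grid_dist 2 ({..<m} \<times> {..<n}) D"
    using assms(3) covering_radius_eq_iff[OF G, of D 2] D(1)
    unfolding perfect_code_def V covers_def by auto
  \<comment> \<open>The transposed code reduces the case \<open>n = 3\<close> to a grid whose first
    side is 3.\<close>
  define D' where "D' = prod.swap ` D"
  have swap: "grid_dist (prod.swap x) (prod.swap y) = grid_dist x y" for x y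
    by (simp add: prod_dist_def)
  have D': "D' \<subseteq> {..<n} \<times> {..<m}" "separated grid_dist D'"
    using D by (auto simp: D'_def separated_def swap)
  have "covers grid_dist 2 (prod.swap ` ({..<m} \<times> {..<n})) D'"
    using cov unfolding D'_def covers_def by (simp add: swap)
  then have cov': "covers grid_dist 2 ({..<n} \<times> {..<m}) D'"
    by (simp add: product_swap)
  consider "m = 3" "n = 3" | "m = 3" "4 \<le> n" | "n = 3" "4 \<le> m" | "4 \<le> m" "4 \<le> n"
    using assms by linarith
  then show ?thesis
  proof cases
    case 1
    then show ?thesis using stackable_3_3 by simp
  next
    case 2
    then show ?thesis using stackable_3 D cov by blast
  next
    case 3
    then show ?thesis using stackable_3 D' cov' stackable_commute by blast
  next
    case 4
    then show ?thesis using perfect_grid_code_size[OF D cov] stackable_6_6 by simp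
  qed
qed

theorem theorem2:
  fixes m n :: nat
  assumes "m \<ge> 3" and "n \<ge> 3"
    and "\<exists>D. perfect_code (path_graph m \<box> path_graph n) 2 D"
  shows "\<forall>k::nat. k \<ge> 1 \<longrightarrow>
    (\<exists>D. quasi_perfect_code (path_graph m \<box> path_graph n \<box> path_graph (6 * k - 2)) 2 D)"
  using assms perfect_code_imp_stackable stackable_imp_quasi_perfect_code by blast

end
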